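(* If $P$ is a Forman--Ricci-positive $3$-dimensional polytope, then $f_0(P)\leq 16$ or $f_2(P)\leq 16$.
   Context: $f_0(P)$ is the number of vertices and $f_2(P)$ the number of $2$-faces of $P$. For an edge $e$ of a polytope $P$, $\mathcal{F}\uparrow(e)$ is the set of $2$-faces containing $e$; two distinct edges are parallel neighbors if either they share a vertex but lie in no common $2$-face, or they are vertex-disjoint but lie in a common $2$-face; $\mathcal{E}(e)$ is the set of parallel neighbors of $e$; the Forman--Ricci curvature is $\mathcal{F}(e)=|\mathcal{F}\uparrow(e)|+2-|\mathcal{E}(e)|$. $P$ is Forman--Ricci-positive if $\mathcal{F}(e)>0$ for all edges $e$. *)

theory Defs
  imports "HOL-Analysis.Analysis"
begin

definition vertices :: "'a::euclidean_space set \<Rightarrow> 'a set" where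
  "vertices P = {v. v extreme_point_of P}"

definition two_faces :: "'a::euclidean_space set \<Rightarrow> 'a set set" where
  "two_faces P = {F. F face_of P \<and> aff_dim F = 2}"

definition f0 :: "'a::euclidean_space set \<Rightarrow> nat" where
  "f0 P = card (vertices P)"

definition f2 :: "'a::euclidean_space set \<Rightarrow> nat" where
  "f2 P = card (two_faces P)"

definition two_faces_above :: "'a::euclidean_space set \<Rightarrow> 'a set \<Rightarrow> 'a set set" where
  "two_faces_above P e = {F \<in> two_faces P. e \<subseteq> F}"

definition share_vertex :: "'a::euclidean_space set \<Rightarrow> 'a set \<Rightarrow> 'a set \<Rightarrow> bool" where
  "share_vertex P e e' \<longleftrightarrow> (\<exists>v \<in> vertices P. v \<in> e \<and> v \<in> e')"

definition share_two_face :: "'a::euclidean_space set \<Rightarrow> 'a set \<Rightarrow> 'a set \<Rightarrow> bool" where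
  "share_two_face P e e' \<longleftrightarrow> (\<exists>F \<in> two_faces P. e \<subseteq> F \<and> e' \<subseteq> F)"

definition parallel_neighbors :: "'a::euclidean_space set \<Rightarrow> 'a set \<Rightarrow> 'a set set" where
  "parallel_neighbors P e =
     {e'. e' edge_of P \<and> e' \<noteq> e \<and>
          (share_vertex P e e' \<and> \<not> share_two_face P e e' \<or>
           \<not> share_vertex P e e' \<and> share_two_face P e e')}"

(* Integer-valued, since the curvature can be negative. *)
definition forman_ricci :: "'a::euclidean_space set \<Rightarrow> 'a set \<Rightarrow> int" where
  "forman_ricci P e =
     int (card (two_faces_above P e)) + 2 - int (card (parallel_neighbors P e))"

definition forman_ricci_positive :: "'a::euclidean_space set \<Rightarrow> bool" where
  "forman_ricci_positive P \<longleftrightarrow> (\<forall>e. e edge_of P \<longrightarrow> forman_ricci P e > 0)"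

end

theory Submission
  imports Defs
begin

text \<open>
  An edge \<open>e\<close> with ends of degrees \<open>d\<^sub>1\<close>, \<open>d\<^sub>2\<close> in faces with \<open>p\<^sub>1\<close>, \<open>p\<^sub>2\<close> sides has at least
  \<open>d\<^sub>1 + d\<^sub>2 + p\<^sub>1 + p\<^sub>2 - 12\<close> parallel neighbors, so positivity forces \<open>d\<^sub>1 + d\<^sub>2 + p\<^sub>1 + p\<^sub>2 \<le> 15\<close>, and the
  harmonic mean inequality bounds the sum of the four reciprocals below by \<open>16 / 15\<close>. Summed over
  the \<open>E\<close> edges, these reciprocals give at most \<open>f0 P + f2 P\<close>, and \<open>f0 P + f2 P \<le> E + 2\<close> by Euler;
  hence \<open>E \<le> 30\<close> and \<open>f0 P + f2 P \<le> 32\<close>.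

  Only this half of Euler's formula is needed. Order the vertices by a generic linear functional,
  and charge each edge and each 2-face to its top vertex. Every edge lies in two 2-faces and every
  2-face has two edges at each of its vertices, so a vertex is charged at most as many 2-faces as
  edges. The inequality is strict at any vertex that is neither the highest nor the lowest of \<open>P\<close>,
  because there some 2-face is crossed by the level set of the functional and yet contains
  an edge descending from that vertex.
\<close>

section \<open>Facets and ridges of a polyhedron\<close>

text \<open>The right-hand side is affine and contains \<open>insert a S\<close>. Measuring the new
  direction from a base point \<open>r\<close> of the hull leaves its coefficient \<open>u\<close>
  free, which gives usable coordinates.\<close>

lemma affine_hull_insert_subset:
  fixes r :: "'a::real_vector"
  assumes "r \<in> affine hull S"
  shows "affine hull (insert a S) \<subseteq> {q + u *\<^sub>R (a - r) | q u. q \<in> affine hull S}"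
proof (rule hull_minimal)
  have "a = r + 1 *\<^sub>R (a - r)" by simp
  then have "a \<in> {q + u *\<^sub>R (a - r) | q u. q \<in> affine hull S}"
    using assms by blast
  moreover have "x \<in> {q + u *\<^sub>R (a - r) | q u. q \<in> affine hull S}" if "x \<in> S" for x
  proof -
    have "x = x + 0 *\<^sub>R (a - r)" by simp
    then show ?thesis using hull_inc[OF that] by blast
  qed
  ultimately show "insert a S \<subseteq> {q + u *\<^sub>R (a - r) | q u. q \<in> affine hull S}" by blast
  show "affine {q + u *\<^sub>R (a - r) | q u. q \<in> affine hull S}"
  proof (rule iffD2[OF affine_def], intro ballI allI impI)
    fix x y and s t :: real
    assume "x \<in> {q + u *\<^sub>R (a - r) | q u. q \<in> affine hull S}"
      and "y \<in> {q + u *\<^sub>R (a - r) | q u. q \<in> affine hull S}" and st: "s + t = 1"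
    then obtain q q' u u' where *: "x = q + u *\<^sub>R (a - r)" "y = q' + u' *\<^sub>R (a - r)"
      "q \<in> affine hull S" "q' \<in> affine hull S" by blast
    have "s *\<^sub>R q + t *\<^sub>R q' \<in> affine hull S"
      using affine_affine_hull[of S] * st unfolding affine_def by blast
    moreover have "s *\<^sub>R x + t *\<^sub>R y = (s *\<^sub>R q + t *\<^sub>R q') + (s * u + t * u') *\<^sub>R (a - r)"
      unfolding * by (simp add: algebra_simps)
    ultimately show "s *\<^sub>R x + t *\<^sub>R y \<in> {q + u *\<^sub>R (a - r) | q u. q \<in> affine hull S}"
      by blast
  qed
qed

text \<open>A dimension squeeze: distinct facets meet in a proper face of one of them, so in
  dimension at most \<open>aff_dim S - 2\<close>, and a face strictly containing \<open>R\<close>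
  would have larger dimension than that.\<close>

lemma facets_Int_eq_ridge:
  fixes S :: "'a::euclidean_space set"
  assumes "F1 facet_of S" "F2 facet_of S" "F1 \<noteq> F2"
    and R: "R face_of S" "aff_dim R = aff_dim S - 2" "R \<subseteq> F1" "R \<subseteq> F2"
  shows "F1 \<inter> F2 = R"
proof (rule ccontr)
  assume ne: "F1 \<inter> F2 \<noteq> R"
  have F: "F1 face_of S" "F2 face_of S" "aff_dim F1 = aff_dim S - 1" "aff_dim F2 = aff_dim S - 1"
    using assms unfolding facet_of_def by auto
  have I: "F1 \<inter> F2 face_of S" using F face_of_Int by blast
  have "R face_of F1 \<inter> F2"
    using R face_of_subset[OF R(1), of "F1 \<inter> F2"] face_of_imp_subset[OF F(1)] by simp (meson inf.coboundedI1)
  then have "aff_dim R < aff_dim (F1 \<inter> F2)"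
    using ne I face_of_aff_dim_lt face_of_imp_convex by blast
  moreover have "F1 \<inter> F2 \<noteq> F1 \<or> F1 \<inter> F2 \<noteq> F2" using assms(3) by auto
  then have "aff_dim (F1 \<inter> F2) < aff_dim S - 1"
  proof
    assume "F1 \<inter> F2 \<noteq> F1"
    moreover have "F1 \<inter> F2 face_of F1" using I F face_of_face by blast
    ultimately show ?thesis using F face_of_aff_dim_lt face_of_imp_convex by metis
  next
    assume "F1 \<inter> F2 \<noteq> F2"
    moreover have "F1 \<inter> F2 face_of F2" using I F face_of_face by blast
    ultimately show ?thesis using F face_of_aff_dim_lt face_of_imp_convex by metis
  qed
  ultimately show False using R by linarith
qed

lemma facet_of_polyhedron_supporting:
  fixes S :: "'a::euclidean_space set"
  assumes "polyhedron S" "F facet_of S"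
  obtains a b where "\<And>x. x \<in> S \<Longrightarrow> a \<bullet> x \<le> b" "\<And>x. x \<in> F \<Longrightarrow> a \<bullet> x = b"
    "\<And>x. x \<in> S - F \<Longrightarrow> a \<bullet> x < b"
proof -
  have "F exposed_face_of S"
    using assms exposed_face_of_polyhedron facet_of_imp_face_of by blast
  then obtain a b where ab: "S \<subseteq> {x. a \<bullet> x \<le> b}" "F = S \<inter> {x. a \<bullet> x = b}"
    unfolding exposed_face_of_def by blast
  show ?thesis
  proof
    show le: "a \<bullet> x \<le> b" if "x \<in> S" for x using ab(1) that by blast
    show "a \<bullet> x = b" if "x \<in> F" for x using ab(2) that by blast
    show "a \<bullet> x < b" if "x \<in> S - F" for x
      using le[of x] ab(2) that by (simp add: order_less_le)
  qed
qed

lemma hyperplane_affine_hull: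
  assumes "\<And>x. x \<in> S \<Longrightarrow> a \<bullet> x = b" "x \<in> affine hull S"
  shows "a \<bullet> x = b"
proof -
  have "affine hull S \<subseteq> {x. a \<bullet> x = b}"
    using assms(1) by (intro hull_minimal affine_hyperplane) auto
  then show ?thesis using assms(2) by blast
qed

text \<open>Modulo the directions of \<open>R\<close>, the polyhedron lies in the wedge spanned by
  one direction into each facet. The coordinates exist because \<open>R\<close>, \<open>p1\<close>
  and \<open>p2\<close> span the affine hull of \<open>S\<close>; the supporting functionals of the
  two facets determine their signs.\<close>

lemma ridge_wedge:
  fixes S :: "'a::euclidean_space set"
  assumes S: "polyhedron S"
    and F: "F1 facet_of S" "F2 facet_of S"
    and R: "aff_dim R = aff_dim S - 2" "R \<subseteq> F1" "R \<subseteq> F2" "r \<in> R"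
    and p: "p1 \<in> F1 - F2" "p2 \<in> F2 - F1" "p \<in> S"
  obtains u w q where "u \<ge> 0" "w \<ge> 0" "q \<in> affine hull R"
    "p = q + u *\<^sub>R (p1 - r) + w *\<^sub>R (p2 - r)"
proof -
  obtain a1 b1 where a1: "\<And>x. x \<in> S \<Longrightarrow> a1 \<bullet> x \<le> b1" "\<And>x. x \<in> F1 \<Longrightarrow> a1 \<bullet> x = b1"
    "\<And>x. x \<in> S - F1 \<Longrightarrow> a1 \<bullet> x < b1"
    using facet_of_polyhedron_supporting[OF S F(1)] by blast
  obtain a2 b2 where a2: "\<And>x. x \<in> S \<Longrightarrow> a2 \<bullet> x \<le> b2" "\<And>x. x \<in> F2 \<Longrightarrow> a2 \<bullet> x = b2"
    "\<And>x. x \<in> S - F2 \<Longrightarrow> a2 \<bullet> x < b2"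
    using facet_of_polyhedron_supporting[OF S F(2)] by blast
  have FS: "F1 \<subseteq> S" "F2 \<subseteq> S" using F facet_of_imp_subset by auto
  have h1: "a1 \<bullet> x = b1" if "x \<in> affine hull (insert p1 R)" for x
    using that by (rule hyperplane_affine_hull[rotated]) (use a1(2) R p in auto)
  have h2: "a2 \<bullet> x = b2" if "x \<in> affine hull R" for x
    using that by (rule hyperplane_affine_hull[rotated]) (use a2(2) R p in auto)
  have n1: "a1 \<bullet> p2 < b1" "a2 \<bullet> p1 < b2"
    using a1(3) a2(3) p FS by auto
  have "p1 \<notin> affine hull R" "p2 \<notin> affine hull (insert p1 R)" using h1 h2 n1 by force+
  \<comment> \<open>Each of the two points raises the dimension by one, which makes up for the
    codimension 2 of \<open>R\<close>.\<close>
  then have "aff_dim (insert p2 (insert p1 R)) = aff_dim S" using R by (simp add: aff_dim_insert)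
  moreover have "insert p2 (insert p1 R) \<subseteq> S" using FS R p by auto
  ultimately have "affine hull (insert p2 (insert p1 R)) = affine hull S"
    using aff_dim_eq_full_gen by blast
  then have "p \<in> affine hull (insert p2 (insert p1 R))" using p hull_inc by metis
  moreover have r: "r \<in> affine hull R" "r \<in> affine hull (insert p1 R)"
    using R by (auto intro: hull_inc)
  ultimately obtain q' w where q': "p = q' + w *\<^sub>R (p2 - r)" "q' \<in> affine hull (insert p1 R)"
    using affine_hull_insert_subset by fast
  then obtain q u where q: "q' = q + u *\<^sub>R (p1 - r)" "q \<in> affine hull R"
    using affine_hull_insert_subset r by fast
  have r1: "a1 \<bullet> r = b1" "a2 \<bullet> r = b2" using h1 h2 r by auto
  \<comment> \<open>The functional \<open>a1\<close> is constant on \<open>R\<close> and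
    \<open>p1\<close>, so it isolates \<open>w\<close>; in the same way \<open>a2\<close> isolates
    \<open>u\<close> below.\<close>
  have "a1 \<bullet> p = b1 + w * (a1 \<bullet> p2 - b1)"
    using h1[OF q'(2)] r1 unfolding q' by (simp add: inner_simps)
  then have "w * (b1 - a1 \<bullet> p2) \<ge> 0" using a1(1)[OF p(3)] by (simp add: algebra_simps)
  then have w: "w \<ge> 0" using n1 by (simp add: zero_le_mult_iff)
  have 0: "a2 \<bullet> p2 = b2" using a2(2) p by auto
  have "a2 \<bullet> p = b2 + u * (a2 \<bullet> p1 - b2)"
    using h2[OF q(2)] r1 0 unfolding q' q by (simp add: inner_simps)
  then have "u * (b2 - a2 \<bullet> p1) \<ge> 0" using a2(1)[OF p(3)] by (simp add: algebra_simps)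
  then have u: "u \<ge> 0" using n1 by (simp add: zero_le_mult_iff)
  show ?thesis using that[OF u w q(2)] q' q by auto
qed

text \<open>The diamond property in codimension 2. One facet is too few, since \<open>R\<close> is
  the intersection of the facets containing it and is not a facet. With a third facet
  \<open>F3\<close>, the wedge of the first two contains a point \<open>p3\<close> of
  \<open>F3\<close> outside \<open>R\<close>; as \<open>p1\<close> and \<open>p2\<close> lie
  strictly inside the half-space of \<open>F3\<close>, both wedge coefficients of \<open>p3\<close>
  vanish, which puts it back into \<open>R\<close>.\<close>

lemma card_facets_containing_ridge:
  fixes S :: "'a::euclidean_space set"
  assumes S: "polyhedron S" and R: "R face_of S" "R \<noteq> {}" "aff_dim R = aff_dim S - 2"
  shows "card {F. F facet_of S \<and> R \<subseteq> F} = 2"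
proof -
  let ?A = "{F. F facet_of S \<and> R \<subseteq> F}"
  have RS: "R \<noteq> S" using R by auto
  have fin: "finite ?A" using finite_polyhedron_facets[OF S] by (auto intro: rev_finite_subset)
  have RI: "R = \<Inter>?A" using face_of_polyhedron[OF S R(1,2) RS] .
  have "?A \<noteq> {}" using face_of_polyhedron_subset_facet[OF S R(1,2) RS] by blast
  then have "card ?A \<noteq> 0" using fin by simp
  moreover have "card ?A \<noteq> 1"
  proof
    assume "card ?A = 1"
    then obtain F where F: "?A = {F}" using card_1_singletonE by blast
    then have "R = F" using RI by simp
    moreover have "aff_dim F = aff_dim S - 1" using F unfolding facet_of_def by blast
    ultimately show False using R by simp
  qed
  moreover have "\<not> card ?A \<ge> 3"
  proof
    assume "card ?A \<ge> 3"
    then obtain B where "B \<subseteq> ?A" "card B = 3" by (meson obtain_subset_with_card_n)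
    then obtain F1 F2 F3 where B: "{F1, F2, F3} \<subseteq> ?A" and
      ne: "F1 \<noteq> F2" "F2 \<noteq> F3" "F1 \<noteq> F3"
      unfolding card_3_iff by metis
    then have F: "F1 \<in> ?A" "F2 \<in> ?A" "F3 \<in> ?A" by auto
    have I: "F1 \<inter> F2 = R" "F1 \<inter> F3 = R" "F2 \<inter> F3 = R"
      using facets_Int_eq_ridge[OF _ _ _ R(1,3)] F ne by auto
    have ex: "\<exists>p. p \<in> F - R" if "F \<in> ?A" for F
    proof -
      have "\<not> F \<subseteq> R" using that R aff_dim_subset[of F R] unfolding facet_of_def by auto
      then show ?thesis by blast
    qed
    obtain p1 p2 p3 where p: "p1 \<in> F1 - R" "p2 \<in> F2 - R" "p3 \<in> F3 - R"
      using ex[OF F(1)] ex[OF F(2)] ex[OF F(3)] by (elim exE) rule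
    obtain r where r: "r \<in> R" using R by blast
    have FS: "F1 \<subseteq> S" "F2 \<subseteq> S" "F3 \<subseteq> S" using F facet_of_imp_subset by blast+
    have F': "F1 facet_of S" "F2 facet_of S" "R \<subseteq> F1" "R \<subseteq> F2" using F by simp_all
    have p': "p1 \<in> F1 - F2" "p2 \<in> F2 - F1" "p3 \<in> S"
      using p(1) I(1) p(2) p(3) FS(3) by auto
    obtain u w q where q: "u \<ge> 0" "w \<ge> 0" "q \<in> affine hull R"
      "p3 = q + u *\<^sub>R (p1 - r) + w *\<^sub>R (p2 - r)"
      using ridge_wedge[OF S F'(1,2) R(3) F'(3,4) r p'] by blast
    obtain a b where a: "\<And>x. x \<in> S \<Longrightarrow> a \<bullet> x \<le> b" "\<And>x. x \<in> F3 \<Longrightarrow> a \<bullet> x = b"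
    "\<And>x. x \<in> S - F3 \<Longrightarrow> a \<bullet> x < b"
      using facet_of_polyhedron_supporting[OF S, of F3] F by blast
    have RF3: "R \<subseteq> F3" using F by auto
    have aq: "a \<bullet> q = b"
      using q(3) by (rule hyperplane_affine_hull[rotated]) (use a(2) RF3 in auto)
    have "p1 \<in> S - F3" "p2 \<in> S - F3" using p(1,2) I(2,3) FS(1,2) by auto
    then have n: "a \<bullet> p1 < b" "a \<bullet> p2 < b" using a(3) by blast+
    have "a \<bullet> r = b" "a \<bullet> p3 = b" using a(2) r p RF3 by auto
    then have "u * (b - a \<bullet> p1) + w * (b - a \<bullet> p2) = 0"
      using aq unfolding q(4) by (simp add: inner_simps algebra_simps)
    moreover have "u * (b - a \<bullet> p1) \<ge> 0" "w * (b - a \<bullet> p2) \<ge> 0" using n q by auto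
    ultimately have "u * (b - a \<bullet> p1) = 0" "w * (b - a \<bullet> p2) = 0" by linarith+
    then have "u = 0" "w = 0" using n by auto
    then have "p3 \<in> affine hull R" using q by simp
    then show False
      using face_of_imp_eq_affine_Int[OF polyhedron_imp_convex[OF S] R(1)] p(3) FS(3) by blast
  qed
  ultimately show ?thesis by linarith
qed

section \<open>Vertices, generic functionals and edges of a polytope\<close>

lemma polytope_face_eq_convex_hull_vertices:
  assumes "polytope P" "K face_of P"
  shows "K = convex hull (vertices P \<inter> K)"
proof -
  have "polytope K" using assms face_of_polytope_polytope by blast
  then have "K = convex hull {x. x extreme_point_of K}"
    using Krein_Milman_Minkowski polytope_imp_compact polytope_imp_convex by blast
  moreover have "{x. x extreme_point_of K} = vertices P \<inter> K"
    unfolding vertices_def using extreme_point_of_face[OF assms(2)] by auto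
  ultimately show ?thesis by simp
qed

lemma finite_vertices: "polytope P \<Longrightarrow> finite (vertices P)"
  unfolding vertices_def
  by (rule finite_polyhedron_extreme_points[OF polytope_imp_polyhedron])

text \<open>The maximizers of \<open>c\<close> on \<open>K\<close> form a face, hence the convex
  hull of its vertices, and injectivity leaves only \<open>v\<close> among these.\<close>

lemma inj_on_vertices_unique_maximum:
  assumes P: "polytope P" and inj: "inj_on ((\<bullet>) c) (vertices P)"
    and K: "K face_of P" and v: "v \<in> vertices P" "v \<in> K" "\<And>x. x \<in> K \<Longrightarrow> c \<bullet> x \<le> c \<bullet> v"
    and x: "x \<in> K" "c \<bullet> x = c \<bullet> v"
  shows "x = v"
proof -
  let ?D = "K \<inter> {y. c \<bullet> y = c \<bullet> v}"
  have "?D face_of K"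
    using face_of_Int_supporting_hyperplane_le face_of_imp_convex K v(3) by blast
  then have "?D face_of P" using K face_of_trans by blast
  then have "?D = convex hull (vertices P \<inter> ?D)"
    using polytope_face_eq_convex_hull_vertices P by blast
  moreover have "vertices P \<inter> ?D \<subseteq> {v}" using inj v unfolding inj_on_def by blast
  then have "convex hull (vertices P \<inter> ?D) \<subseteq> {v}"
    by (metis hull_mono convex_hull_singleton)
  ultimately show ?thesis using x by blast
qed

text \<open>The maximum over the finitely many vertices of \<open>K\<close> bounds \<open>c\<close>
  on their convex hull. Uniqueness makes the charging of faces to top vertices well defined.\<close>

lemma ex1_top_vertex:
  assumes P: "polytope P" and inj: "inj_on ((\<bullet>) c) (vertices P)"
    and K: "K face_of P" "K \<noteq> {}"
  shows "\<exists>!v. v \<in> vertices P \<and> v \<in> K \<and> (\<forall>x\<in>K. c \<bullet> x \<le> c \<bullet> v)"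
proof -
  let ?W = "vertices P \<inter> K"
  have KW: "K = convex hull ?W" using polytope_face_eq_convex_hull_vertices P K by blast
  have W: "finite ?W" "?W \<noteq> {}"
    using finite_vertices[OF P] KW K(2) by (simp, metis convex_hull_empty)
  have "Max ((\<bullet>) c ` ?W) \<in> (\<bullet>) c ` ?W" using W by (intro Max_in) auto
  then obtain v where vW: "v \<in> ?W" "c \<bullet> v = Max ((\<bullet>) c ` ?W)" by auto
  have v: "c \<bullet> x \<le> c \<bullet> v" if "x \<in> ?W" for x
    unfolding vW(2) using W(1) that by (intro Max_ge) auto
  have "convex hull ?W \<subseteq> {x. c \<bullet> x \<le> c \<bullet> v}"
    using v by (intro hull_minimal convex_halfspace_le subsetI) simp
  then have top: "\<forall>x\<in>K. c \<bullet> x \<le> c \<bullet> v" using KW by blast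
  have "v' = v" if "v' \<in> vertices P" "v' \<in> K" "\<forall>x\<in>K. c \<bullet> x \<le> c \<bullet> v'" for v'
  proof -
    have "c \<bullet> v = c \<bullet> v'" using top that vW(1) by (intro order_antisym) auto
    then show ?thesis using inj_onD[OF inj] vW(1) that(1) by auto
  qed
  then show ?thesis using vW(1) top by blast
qed

text \<open>A bad \<open>c\<close> is orthogonal to some difference \<open>x - y\<close> of distinct
  points of \<open>V\<close>; finitely many hyperplanes form a null set.\<close>

lemma ex_inj_on_inner:
  fixes V :: "'a::euclidean_space set"
  assumes "finite V"
  shows "\<exists>c. inj_on ((\<bullet>) c) V"
proof -
  let ?N = "\<Union>(x, y)\<in>{(x, y) \<in> V \<times> V. x \<noteq> y}. {c. (x - y) \<bullet> c = 0}"
  have "finite {(x, y) \<in> V \<times> V. x \<noteq> y}" using assms by (auto intro: finite_subset[of _ "V \<times> V"])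
  then have "negligible ?N"
    by (intro negligible_Union finite_imageI) (auto intro: negligible_hyperplane)
  then have "?N \<noteq> UNIV" using non_negligible_UNIV by force
  then obtain c where "c \<notin> ?N" by blast
  have "inj_on ((\<bullet>) c) V"
  proof (rule inj_onI, rule ccontr)
    fix x y assume "x \<in> V" "y \<in> V" "c \<bullet> x = c \<bullet> y" "x \<noteq> y"
    moreover from this have "(x - y) \<bullet> c = 0"
      by (simp add: inner_commute[of "x - y" c] inner_diff_right)
    ultimately show False using \<open>c \<notin> ?N\<close> by auto
  qed
  then show ?thesis ..
qed

lemma card_vertices_edge:
  assumes P: "polytope P" and e: "e edge_of P"
  shows "card (vertices P \<inter> e) = 2"
proof -
  have ef: "e face_of P" "aff_dim e = 1" using e unfolding edge_of_def by auto
  have "polytope e" using P ef face_of_polytope_polytope by blast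
  then have "compact e" "convex e" "collinear e"
    using polytope_imp_compact polytope_imp_convex ef collinear_aff_dim by (blast, blast, force)
  moreover have "e \<noteq> {}" using ef by auto
  ultimately obtain a b where ab: "e = closed_segment a b"
    using compact_convex_collinear_segment by blast
  have "a \<noteq> b" using ab ef by auto
  moreover have "vertices P \<inter> e = {a, b}"
    using extreme_point_of_face[OF ef(1)] extreme_point_of_segment[of _ a b]
    unfolding vertices_def ab by auto
  ultimately show ?thesis by simp
qed

text \<open>An edge is the convex hull of its two vertices. This later rules out counting one edge
  at both ends of \<open>e\<close>.\<close>

lemma edge_eqI:
  assumes P: "polytope P" and e: "e edge_of P" "e' edge_of P"
    and uv: "{u, v} \<subseteq> vertices P \<inter> e \<inter> e'" "u \<noteq> v"
  shows "e = e'"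
proof -
  have "finite (vertices P)" using finite_vertices P by blast
  moreover have "{u, v} \<subseteq> vertices P \<inter> e" "{u, v} \<subseteq> vertices P \<inter> e'" using uv by auto
  ultimately have "{u, v} = vertices P \<inter> e" "{u, v} = vertices P \<inter> e'"
    using card_vertices_edge[OF P e(1)] card_vertices_edge[OF P e(2)] uv(2)
    by (metis card_2_iff card_subset_eq finite_Int)+
  then show ?thesis
    using polytope_face_eq_convex_hull_vertices[OF P] e unfolding edge_of_def by metis
qed

text \<open>The right-hand side is the tangent of \<open>1 / x\<close> at \<open>x = 15 / 4\<close>.\<close>

lemma inverse_ge_tangent: "x > 0 \<Longrightarrow> 1 / x \<ge> 8 / 15 - 16 / 225 * (x::real)"
proof -
  assume x: "x > 0"
  have "(4 * x - 15)\<^sup>2 \<ge> 0" by simp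
  then have "(8 / 15 - 16 / 225 * x) * x \<le> 1" by (simp add: power2_eq_square algebra_simps)
  then show ?thesis using x by (simp add: pos_le_divide_eq)
qed

text \<open>After exchanging the sums, each \<open>a\<close> related to some \<open>b\<close>
  contributes exactly 1 and every other \<open>a\<close> contributes 0.\<close>

lemma sum_inverse_degree_le:
  fixes R :: "'b \<Rightarrow> 'c \<Rightarrow> bool"
  assumes "finite A" "finite B"
  shows "(\<Sum>b\<in>B. \<Sum>a\<in>{a \<in> A. R a b}. 1 / real (card {b \<in> B. R a b})) \<le> real (card A)"
proof -
  have "(\<Sum>b\<in>B. \<Sum>a\<in>{a \<in> A. R a b}. 1 / real (card {b \<in> B. R a b})) =
    (\<Sum>a\<in>A. \<Sum>b\<in>{b \<in> B. R a b}. 1 / real (card {b \<in> B. R a b}))"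
    using sum.swap_restrict[OF assms(2,1)] .
  also have "\<dots> \<le> (\<Sum>a\<in>A. 1)" by (rule sum_mono) simp
  finally show ?thesis by simp
qed

section \<open>Incidences in a 3-polytope\<close>

locale polytope3 =
  fixes P :: "'a::euclidean_space set"
  assumes polytope: "polytope P" and aff_dim: "aff_dim P = 3"
begin

lemma polyhedron: "polyhedron P"
  by (rule polytope_imp_polyhedron[OF polytope])

lemma two_face_iff_facet: "F \<in> two_faces P \<longleftrightarrow> F facet_of P"
  unfolding two_faces_def facet_of_def using aff_dim by auto

lemma edge_iff_facet_of_two_face:
  assumes "F \<in> two_faces P"
  shows "e facet_of F \<longleftrightarrow> e edge_of P \<and> e \<subseteq> F"
proof -
  have F: "F face_of P" "aff_dim F = 2" using assms unfolding two_faces_def by auto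
  show ?thesis unfolding facet_of_def edge_of_def face_of_face[OF F(1)] F(2) by auto
qed

lemma polyhedron_two_face:
  assumes "F \<in> two_faces P"
  shows "polyhedron F"
  using assms face_of_polyhedron_polyhedron[OF polyhedron] unfolding two_faces_def by simp

lemma finite_edges: "finite {e. e edge_of P}"
  using finite_polyhedron_faces[OF polyhedron] unfolding edge_of_def
  by (rule rev_finite_subset) auto

lemma finite_two_faces: "finite (two_faces P)"
  using finite_polyhedron_faces[OF polyhedron] unfolding two_faces_def
  by (rule rev_finite_subset) auto

lemma card_two_faces_above:
  assumes "e edge_of P"
  shows "card (two_faces_above P e) = 2"
proof -
  have "e face_of P" "aff_dim e = aff_dim P - 2" "e \<noteq> {}"
    using assms aff_dim unfolding edge_of_def by auto
  then show ?thesis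
    unfolding two_faces_above_def two_face_iff_facet
    by (intro card_facets_containing_ridge[OF polyhedron])
qed

lemma vertex_face_of_two_face:
  assumes "F \<in> two_faces P" "v \<in> vertices P" "v \<in> F"
  shows "{v} face_of F" "aff_dim {v} = aff_dim F - 2"
proof -
  have F: "F face_of P" "aff_dim F = 2" using assms unfolding two_faces_def by auto
  show "{v} face_of F"
    using extreme_point_of_face[OF F(1)] assms unfolding vertices_def face_of_singleton by simp
  show "aff_dim {v} = aff_dim F - 2" using F(2) by simp
qed

text \<open>The ridge count again, one dimension lower: \<open>{v}\<close> is a ridge of the polygon
  \<open>F\<close>, whose facets are the edges of \<open>P\<close> inside \<open>F\<close>.\<close>

lemma card_edges_at_vertex_in_two_face:
  assumes "F \<in> two_faces P" "v \<in> vertices P" "v \<in> F"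
  shows "card {e. e edge_of P \<and> e \<subseteq> F \<and> v \<in> e} = 2"
proof -
  have "card {e. e facet_of F \<and> {v} \<subseteq> e} = 2"
    using card_facets_containing_ridge[OF polyhedron_two_face[OF assms(1)], of "{v}"]
      vertex_face_of_two_face[OF assms] by blast
  then show ?thesis using edge_iff_facet_of_two_face[OF assms(1)] by simp
qed

lemma two_faces_Int_eq_edge:
  assumes "F \<in> two_faces P" "G \<in> two_faces P" "F \<noteq> G" "e edge_of P" "e \<subseteq> F" "e \<subseteq> G"
  shows "F \<inter> G = e"
proof -
  have "F facet_of P" "G facet_of P" using assms(1,2) two_face_iff_facet by auto
  moreover have "e face_of P" "aff_dim e = aff_dim P - 2"
    using assms(4) aff_dim unfolding edge_of_def by auto
  ultimately show ?thesis using facets_Int_eq_ridge assms(3,5,6) by blast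
qed

section \<open>Half of Euler's formula by a generic functional\<close>

text \<open>
  The section of \<open>P\<close> by the level set of \<open>c\<close> through \<open>v\<close> is a polygon with vertex \<open>v\<close>; the
  2-face of \<open>P\<close> carrying a side of this polygon at \<open>v\<close> is crossed by the level set.
\<close>

lemma ex_crossing_two_face:
  assumes inj: "inj_on ((\<bullet>) c) (vertices P)" and v: "v \<in> vertices P"
    and x1: "x1 \<in> P" "c \<bullet> x1 < c \<bullet> v" and x2: "x2 \<in> P" "c \<bullet> x2 > c \<bullet> v"
  shows "\<exists>G \<in> two_faces P. v \<in> G \<and> (\<exists>x\<in>G. c \<bullet> x < c \<bullet> v) \<and> (\<exists>x\<in>G. c \<bullet> x > c \<bullet> v)"
proof -
  define H where "H = {x. c \<bullet> x = c \<bullet> v}"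
  have cP: "convex P" using polyhedron polyhedron_imp_convex by blast
  \<comment> \<open>Strict inequalities are open conditions, so points of \<open>P\<close> on both
    sides of the level set yield relative interior points on both sides; connectedness then puts one
    on the level set.\<close>
  have cl: "P \<subseteq> closure (rel_interior P)"
    using convex_closure_rel_interior[OF cP] closure_subset by blast
  have "{x. c \<bullet> x < c \<bullet> v} \<inter> closure (rel_interior P) \<noteq> {}" using x1 cl by blast
  then obtain y1 where y1: "y1 \<in> rel_interior P" "c \<bullet> y1 < c \<bullet> v"
    using open_Int_closure_eq_empty[OF open_halfspace_lt] by blast
  have "{x. c \<bullet> x > c \<bullet> v} \<inter> closure (rel_interior P) \<noteq> {}" using x2 cl by blast
  then obtain y2 where y2: "y2 \<in> rel_interior P" "c \<bullet> y2 > c \<bullet> v"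
    using open_Int_closure_eq_empty[OF open_halfspace_gt] by blast
  have "connected (rel_interior P)" using convex_rel_interior[OF cP] convex_connected by blast
  then obtain z where z0: "z \<in> rel_interior P" "c \<bullet> z = c \<bullet> v"
    using connected_ivt_hyperplane[of "rel_interior P" y1 y2 c "c \<bullet> v"] y1 y2 by auto
  then have z: "rel_interior P \<inter> H \<noteq> {}" unfolding H_def by blast
  have aH: "affine H" unfolding H_def by (rule affine_hyperplane)
  define Q where "Q = P \<inter> H"
  have Q: "polytope Q"
    unfolding Q_def H_def using polytope polyhedron_hyperplane polytope_Int_polyhedron by blast
  have "aff_dim (affine hull P \<inter> H) = 2"
  proof -
    have "z \<in> affine hull P \<inter> H"
      using z0 rel_interior_subset[of P] hull_inc[of z P affine] unfolding H_def by auto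
    moreover have "x1 \<in> affine hull P" "x1 \<notin> H"
      using x1 hull_inc[of x1 P affine] unfolding H_def by auto
    ultimately show ?thesis
      using aff_dim_affine_Int_hyperplane[of "affine hull P" c "c \<bullet> v"] aff_dim
      unfolding H_def by auto
  qed
  \<comment> \<open>\<open>Q\<close> lies between this relatively open part of a plane and the plane
    itself, which fixes its dimension as 2.\<close>
  moreover have "aff_dim (rel_interior P \<inter> H) = aff_dim (affine hull P \<inter> H)"
  proof (rule aff_dim_openin)
    obtain T where T: "open T" "rel_interior P = affine hull P \<inter> T"
      using openin_rel_interior[of P] unfolding openin_open by blast
    then have "rel_interior P \<inter> H = (affine hull P \<inter> H) \<inter> T" by blast
    then show "openin (top_of_set (affine hull P \<inter> H)) (rel_interior P \<inter> H)"
      using T(1) unfolding openin_open by blast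
    show "affine (affine hull P \<inter> H)" using affine_Int[OF affine_affine_hull aH] .
  qed (fact z)
  moreover have "rel_interior P \<inter> H \<subseteq> Q"
    unfolding Q_def by (rule Int_mono[OF rel_interior_subset order_refl])
  moreover have "Q \<subseteq> affine hull P \<inter> H"
    unfolding Q_def by (rule Int_mono[OF hull_subset order_refl])
  ultimately have dQ: "aff_dim Q = 2" 
    using aff_dim_subset[of Q "affine hull P \<inter> H"] aff_dim_subset[of "rel_interior P \<inter> H" Q]
    by simp
  have "{v} face_of P" using v unfolding vertices_def by (simp add: face_of_singleton)
  then have "{v} \<inter> H face_of Q" unfolding Q_def using affine_imp_convex[OF aH] face_of_slice by blast
  then have vQ: "{v} face_of Q" unfolding H_def by simp
  moreover have "{v} \<noteq> Q" using dQ by auto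
  ultimately obtain J where J: "J facet_of Q" "v \<in> J"
    using face_of_polyhedron_subset_facet[OF polytope_imp_polyhedron[OF Q], of "{v}"] by blast
  have dJ: "aff_dim J = 1" using J(1) dQ unfolding facet_of_def by simp
  have Jf: "J face_of Q" "J \<noteq> Q" using J(1) dJ dQ facet_of_imp_face_of by auto
  have JP: "J \<subseteq> P" "J \<subseteq> H" using face_of_imp_subset[OF Jf(1)] unfolding Q_def by auto
  have "rel_interior J \<noteq> {}"
    using J(2) rel_interior_eq_empty[OF face_of_imp_convex[OF Jf(1)]] by blast
  then obtain x where x: "x \<in> rel_interior J" by blast
  have "rel_interior Q = rel_interior P \<inter> H"
    unfolding Q_def using convex_affine_rel_interior_Int[OF cP aH z] .
  \<comment> \<open>The proper face \<open>J\<close> of \<open>Q\<close> misses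
    \<open>rel_interior Q\<close>, which within \<open>H\<close> is the relative interior of
    \<open>P\<close>.\<close>
  then have "x \<in> P - rel_interior P"
    using face_of_disjoint_rel_interior[OF Jf] x rel_interior_subset[of J] JP by blast
  then obtain G where G: "G facet_of P" "x \<in> G"
    using rel_boundary_of_polyhedron[OF polyhedron] by blast
  have Gf: "G face_of P" using G facet_of_imp_face_of by blast
  have JG: "J \<subseteq> G" using subset_of_face_of[OF Gf JP(1)] G x by blast
  have "J \<noteq> {v}" using dJ by auto
  \<comment> \<open>If \<open>v\<close> maximized or minimized \<open>c\<close> on \<open>G\<close>,
    the point \<open>w\<close> at the same height would have to equal \<open>v\<close>. The minimum
    is treated as a maximum of \<open>- c\<close>.\<close>
  then obtain w where w: "w \<in> G" "w \<noteq> v" "c \<bullet> w = c \<bullet> v" using J(2) JP JG unfolding H_def by blast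
  have vG: "v \<in> G" using J JG by blast
  have "\<exists>x\<in>G. c \<bullet> x > c \<bullet> v"
    using inj_on_vertices_unique_maximum[OF polytope inj Gf v vG _ w(1,3)] w(2) by force
  moreover have inj': "inj_on ((\<bullet>) (- c)) (vertices P)" using inj unfolding inj_on_def by simp
  have "\<exists>x\<in>G. c \<bullet> x < c \<bullet> v"
    using inj_on_vertices_unique_maximum[OF polytope inj' Gf v vG _ w(1)] w by force
  ultimately show ?thesis using G vG two_face_iff_facet by blast
qed

text \<open>Otherwise both edges of \<open>F\<close> at \<open>v\<close> contain points above
  \<open>v\<close>, and since \<open>F\<close> lies in the wedge that they span at \<open>v\<close>,
  no point of \<open>F\<close> could be below \<open>v\<close>.\<close>

lemma ex_down_edge:
  assumes F: "F \<in> two_faces P" and v: "v \<in> vertices P" "v \<in> F" and x: "x \<in> F" "c \<bullet> x < c \<bullet> v"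
  shows "\<exists>e. e edge_of P \<and> e \<subseteq> F \<and> v \<in> e \<and> (\<forall>y\<in>e. c \<bullet> y \<le> c \<bullet> v)"
proof (rule ccontr)
  assume neg: "\<not> ?thesis"
  obtain e1 e2 where "{e. e edge_of P \<and> e \<subseteq> F \<and> v \<in> e} = {e1, e2}" and ne: "e1 \<noteq> e2"
    using card_edges_at_vertex_in_two_face[OF F v] by (auto simp: card_2_iff)
  then have e: "e1 edge_of P" "e1 \<subseteq> F" "v \<in> e1" "e2 edge_of P" "e2 \<subseteq> F" "v \<in> e2" by auto
  have f: "e1 facet_of F" "e2 facet_of F" using edge_iff_facet_of_two_face[OF F] e by auto
  note vF = vertex_face_of_two_face[OF F v]
  have I: "e1 \<inter> e2 = {v}" using facets_Int_eq_ridge[OF f ne, of "{v}"] vF e by simp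
  obtain p1 p2 where p: "p1 \<in> e1" "c \<bullet> p1 > c \<bullet> v" "p2 \<in> e2" "c \<bullet> p2 > c \<bullet> v"
    using neg e by (meson not_le)
  then have "p1 \<notin> e2" "p2 \<notin> e1" using I by auto
  then obtain u w q where "u \<ge> 0" "w \<ge> 0" "q \<in> affine hull {v}"
    "x = q + u *\<^sub>R (p1 - v) + w *\<^sub>R (p2 - v)"
    using ridge_wedge[OF polyhedron_two_face[OF F] f, of "{v}" v p1 p2 x] vF e p x by auto
  then have "c \<bullet> x = c \<bullet> v + u * (c \<bullet> p1 - c \<bullet> v) + w * (c \<bullet> p2 - c \<bullet> v)"
    by (simp add: inner_simps)
  moreover have "u * (c \<bullet> p1 - c \<bullet> v) \<ge> 0" "w * (c \<bullet> p2 - c \<bullet> v) \<ge> 0"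
    using p \<open>u \<ge> 0\<close> \<open>w \<ge> 0\<close> by auto
  ultimately show False using x by linarith
qed

text \<open>Count pairs of a descending edge at \<open>v\<close> and a 2-face containing it. Each
  edge occurs twice, and so does each face in \<open>tops\<close>, since both its edges at
  \<open>v\<close> descend. A crossing 2-face is not in \<open>tops\<close> but contains a
  descending edge, which makes the bound strict.\<close>

lemma card_two_faces_at_top_vertex_le:
  assumes inj: "inj_on ((\<bullet>) c) (vertices P)" and v: "v \<in> vertices P"
  defines "tops \<equiv> {F \<in> two_faces P. v \<in> F \<and> (\<forall>x\<in>F. c \<bullet> x \<le> c \<bullet> v)}"
    and "down \<equiv> {e \<in> {e. e edge_of P}. v \<in> e \<and> (\<forall>x\<in>e. c \<bullet> x \<le> c \<bullet> v)}"
  shows "card tops \<le> card down"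
    and "x1 \<in> P \<Longrightarrow> c \<bullet> x1 < c \<bullet> v \<Longrightarrow> x2 \<in> P \<Longrightarrow> c \<bullet> x2 > c \<bullet> v \<Longrightarrow> card tops < card down"
proof -
  define A where "A = {F \<in> two_faces P. v \<in> F}"
  define k where "k F = card {e \<in> down. e \<subseteq> F}" for F
  have fin: "finite A" "finite down"
    unfolding A_def down_def using finite_two_faces finite_edges by auto
  have tA: "tops \<subseteq> A" unfolding tops_def A_def by auto
  have "(\<Sum>F\<in>A. k F) = 2 * card down"
    unfolding k_def
  proof (rule sum_multicount[OF fin], rule ballI)
    fix e assume e: "e \<in> down"
    then have "{F \<in> A. e \<subseteq> F} = two_faces_above P e"
      unfolding A_def down_def two_faces_above_def by auto
    then show "card {F \<in> A. e \<subseteq> F} = 2" using card_two_faces_above e unfolding down_def by simp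
  qed
  moreover have "k F = 2" if F: "F \<in> tops" for F
  proof -
    have "{e \<in> down. e \<subseteq> F} = {e. e edge_of P \<and> e \<subseteq> F \<and> v \<in> e}"
      using F unfolding down_def tops_def by auto
    then show ?thesis
      using card_edges_at_vertex_in_two_face[of F v] F v unfolding k_def tops_def by simp
  qed
  then have "(\<Sum>F\<in>tops. k F) = 2 * card tops" by simp
  moreover have split: "(\<Sum>F\<in>A. k F) = (\<Sum>F\<in>A - tops. k F) + (\<Sum>F\<in>tops. k F)"
    using sum.subset_diff[OF tA fin(1)] .
  ultimately have eq: "2 * card down = (\<Sum>F\<in>A - tops. k F) + 2 * card tops" by simp
  then show "card tops \<le> card down" by simp
  show "card tops < card down"
    if x: "x1 \<in> P" "c \<bullet> x1 < c \<bullet> v" "x2 \<in> P" "c \<bullet> x2 > c \<bullet> v"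
  proof -
    obtain G y1 y2 where G: "G \<in> two_faces P" "v \<in> G" "y1 \<in> G" "c \<bullet> y1 < c \<bullet> v"
      "y2 \<in> G" "c \<bullet> y2 > c \<bullet> v"
      using ex_crossing_two_face[OF inj v x] by blast
    obtain e where e: "e edge_of P" "e \<subseteq> G" "v \<in> e" "\<forall>y\<in>e. c \<bullet> y \<le> c \<bullet> v"
      using ex_down_edge[OF G(1) v G(2-4)] by blast
    have "e \<in> {e \<in> down. e \<subseteq> G}" unfolding down_def using e by simp
    then have "k G > 0" unfolding k_def using fin(2) by (subst card_gt_0_iff) auto
    moreover have "G \<in> A - tops" unfolding A_def tops_def using G by force
    ultimately have "(\<Sum>F\<in>A - tops. k F) > 0" using fin(1) by (simp add: sum_pos2)
    then show ?thesis using eq by simp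
  qed
qed

text \<open>Every edge and every 2-face is charged to exactly one vertex, so the local comparison
  can be summed over the vertices. The summand 2 pays for the highest vertex \<open>a\<close> and
  the lowest vertex \<open>b\<close>.\<close>

lemma card_vertices_two_faces_le:
  "card (vertices P) + card (two_faces P) \<le> card {e. e edge_of P} + 2"
proof -
  let ?V = "vertices P" and ?E = "{e. e edge_of P}" and ?T = "two_faces P"
  have fV: "finite ?V" using finite_vertices polytope by blast
  obtain c where inj: "inj_on ((\<bullet>) c) ?V" using ex_inj_on_inner[OF fV] by blast
  define top where "top v K \<longleftrightarrow> v \<in> K \<and> (\<forall>x\<in>K. c \<bullet> x \<le> c \<bullet> v)" for v K
  have top1: "card {v \<in> ?V. top v K} = 1" if K: "K face_of P" "K \<noteq> {}" for K
  proof -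
    obtain u where "\<And>v. v \<in> ?V \<and> top v K \<longleftrightarrow> v = u"
      using ex1_top_vertex[OF polytope inj K] unfolding top_def by metis
    then have "{v \<in> ?V. top v K} = {u}" by blast
    then show ?thesis by simp
  qed
  have sE: "(\<Sum>v\<in>?V. card {e \<in> ?E. top v e}) = 1 * card ?E"
  proof (rule sum_multicount[OF fV finite_edges], rule ballI)
    fix e assume "e \<in> ?E"
    then have "e face_of P" "e \<noteq> {}" unfolding edge_of_def by auto
    then show "card {v \<in> ?V. top v e} = 1" by (rule top1)
  qed
  have sT: "(\<Sum>v\<in>?V. card {F \<in> ?T. top v F}) = 1 * card ?T"
  proof (rule sum_multicount[OF fV finite_two_faces], rule ballI)
    fix F assume "F \<in> ?T"
    then have "F face_of P" "F \<noteq> {}" unfolding two_faces_def by auto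
    then show "card {v \<in> ?V. top v F} = 1" by (rule top1)
  qed
  have PP: "P face_of P" using polyhedron polyhedron_imp_convex face_of_refl by blast
  have P0: "P \<noteq> {}" using aff_dim by auto
  have inj': "inj_on ((\<bullet>) (- c)) ?V" using inj unfolding inj_on_def by simp
  obtain a where a: "a \<in> ?V" "\<And>v. v \<in> ?V \<Longrightarrow> (\<forall>x\<in>P. c \<bullet> x \<le> c \<bullet> v) \<Longrightarrow> v = a"
    using ex1_top_vertex[OF polytope inj PP P0] face_of_imp_subset
    unfolding vertices_def extreme_point_of_def by (metis (no_types, lifting) mem_Collect_eq)
  obtain b where b: "b \<in> ?V" "\<And>v. v \<in> ?V \<Longrightarrow> (\<forall>x\<in>P. (- c) \<bullet> x \<le> (- c) \<bullet> v) \<Longrightarrow> v = b"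
    using ex1_top_vertex[OF polytope inj' PP P0] face_of_imp_subset
    unfolding vertices_def extreme_point_of_def by (metis (no_types, lifting) mem_Collect_eq)
  \<comment> \<open>The left-hand \<open>+ 1\<close> counts \<open>v\<close> itself. Strictness
    provides it at a vertex between the extremes; at \<open>a\<close> and \<open>b\<close> the
    conditional term does.\<close>
  have le: "card {F \<in> ?T. top v F} + 1 \<le> card {e \<in> ?E. top v e} + (if v \<in> {a, b} then 1 else 0)"
    if v: "v \<in> ?V" for v
  proof (cases "v \<in> {a, b}")
    case True
    then show ?thesis using card_two_faces_at_top_vertex_le(1)[OF inj v] unfolding top_def by simp
  next
    case False
    obtain x2 where x2: "x2 \<in> P" "c \<bullet> x2 > c \<bullet> v" using False a(2)[OF v] by force
    obtain x1 where x1: "x1 \<in> P" "c \<bullet> x1 < c \<bullet> v" using False b(2)[OF v] by force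
    show ?thesis
      using card_two_faces_at_top_vertex_le(2)[OF inj v x1 x2] False unfolding top_def by simp
  qed
  have "card ?T + card ?V = (\<Sum>v\<in>?V. card {F \<in> ?T. top v F} + 1)"
    unfolding sum.distrib using sT by simp
  also have "\<dots> \<le> (\<Sum>v\<in>?V. card {e \<in> ?E. top v e} + (if v \<in> {a, b} then 1 else 0))"
    by (rule sum_mono) (rule le)
  also have "\<dots> = card ?E + (\<Sum>v\<in>?V. if v \<in> {a, b} then 1 else 0)"
    unfolding sum.distrib using sE by simp
  also have "(\<Sum>v\<in>?V. if v \<in> {a, b} then 1 else 0) = card (?V \<inter> {a, b})"
    unfolding card_eq_sum by (rule sum.inter_restrict[OF fV, symmetric])
  also have "\<dots> \<le> card {a, b}" by (intro card_mono) auto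
  also have "\<dots> \<le> 2" by (simp add: card_insert_if)
  finally show ?thesis by simp
qed

section \<open>Parallel neighbors and the bound on the number of edges\<close>

text \<open>The cardinalities of \<open>edges_at v\<close> and \<open>edges_in F\<close> are the
  degree of a vertex and the number of sides of a 2-face. The nested comprehensions match the shape
  \<open>{b \<in> B. R a b}\<close> in \<open>sum_inverse_degree_le\<close>.\<close>

definition edges_at :: "'a \<Rightarrow> 'a set set" where
  "edges_at v = {e \<in> {e. e edge_of P}. v \<in> e}"

definition edges_in :: "'a set \<Rightarrow> 'a set set" where
  "edges_in F = {e \<in> {e. e edge_of P}. e \<subseteq> F}"

lemma finite_edges_at: "finite (edges_at v)"
  unfolding edges_at_def using finite_edges by auto

lemma finite_edges_in: "finite (edges_in F)"
  unfolding edges_in_def using finite_edges by auto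

text \<open>Edges at an end of \<open>e\<close> outside \<open>F\<close> and \<open>G\<close>, and
  edges of \<open>F\<close> or \<open>G\<close> avoiding both ends, are parallel neighbors. At each
  of \<open>u\<close>, \<open>v\<close>, \<open>F\<close>, \<open>G\<close> at most three edges are
  discarded, in total 12. The remaining sets are disjoint: only \<open>e\<close> contains both ends,
  only \<open>e\<close> lies in both faces, and the two kinds differ in meeting the ends of
  \<open>e\<close>.\<close>

lemma card_parallel_neighbors_ge:
  assumes e: "e edge_of P" and uv: "vertices P \<inter> e = {u, v}" "u \<noteq> v"
    and FG: "two_faces_above P e = {F, G}" "F \<noteq> G"
  shows "card (edges_at u) + card (edges_at v) + card (edges_in F) + card (edges_in G)
    \<le> card (parallel_neighbors P e) + 12"
proof -
  have w: "u \<in> vertices P" "u \<in> e" "v \<in> vertices P" "v \<in> e" using uv by auto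
  have sv: "share_vertex P e e' \<longleftrightarrow> u \<in> e' \<or> v \<in> e'" for e'
    using uv(1) unfolding share_vertex_def by auto
  have T: "H \<in> two_faces P \<and> e \<subseteq> H \<longleftrightarrow> H \<in> {F, G}" for H
    unfolding FG(1)[symmetric] two_faces_above_def by simp
  have F: "F \<in> two_faces P" "e \<subseteq> F" and G: "G \<in> two_faces P" "e \<subseteq> G"
    using T[of F] T[of G] by simp_all
  have "share_two_face P e e' \<longleftrightarrow> (\<exists>H\<in>{F, G}. e' \<subseteq> H)" for e'
    unfolding share_two_face_def by (simp only: Bex_def conj_assoc[symmetric] T)
  then have sf: "share_two_face P e e' \<longleftrightarrow> e' \<subseteq> F \<or> e' \<subseteq> G" for e' by simp
  define X where "X z H = {e'. e' edge_of P \<and> e' \<subseteq> H \<and> z \<in> e'}" for z H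
  have fX: "finite (X z H)" for z H unfolding X_def using finite_edges by auto
  have X2: "card (X z H) = 2" "e \<in> X z H" if "z \<in> {u, v}" "H \<in> {F, G}" for z H
    using card_edges_at_vertex_in_two_face[of H z] that F G w e unfolding X_def by auto
  define S where "S z = edges_at z - (X z F \<union> X z G)" for z
  define D where "D H = edges_in H - (X u H \<union> X v H)" for H
  have card3: "card (A \<union> B) \<le> 3" if "card A = 2" "card B = 2" "e \<in> A" "e \<in> B"
    "finite A" "finite B" for A B :: "'a set set"
  proof -
    \<comment> \<open>Both pairs contain \<open>e\<close>, so their union has at most 3 elements
      rather than 4.\<close>
    have "card (A \<union> B) + card (A \<inter> B) = 4" using card_Un_Int that by fastforce
    moreover have "card (A \<inter> B) > 0" using that by (subst card_gt_0_iff) auto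
    ultimately show ?thesis by simp
  qed
  have cS: "card (edges_at z) \<le> card (S z) + 3" if z: "z \<in> {u, v}" for z
  proof -
    have "card (edges_at z) - card (X z F \<union> X z G) \<le> card (S z)"
      unfolding S_def using diff_card_le_card_Diff fX by blast
    moreover have "card (X z F \<union> X z G) \<le> 3"
      by (intro card3 X2 fX) (use z in auto)
    ultimately show ?thesis by simp
  qed
  have cD: "card (edges_in H) \<le> card (D H) + 3" if H: "H \<in> {F, G}" for H
  proof -
    have "card (edges_in H) - card (X u H \<union> X v H) \<le> card (D H)"
      unfolding D_def using diff_card_le_card_Diff fX by blast
    moreover have "card (X u H \<union> X v H) \<le> 3"
      by (intro card3 X2 fX) (use H in auto)
    ultimately show ?thesis by simp
  qed
  have sub: "S u \<union> S v \<union> (D F \<union> D G) \<subseteq> parallel_neighbors P e"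
  proof
    fix e' assume "e' \<in> S u \<union> S v \<union> (D F \<union> D G)"
    then have 1: "e' edge_of P" "(u \<in> e' \<or> v \<in> e') \<noteq> (e' \<subseteq> F \<or> e' \<subseteq> G)"
      unfolding S_def D_def X_def edges_at_def edges_in_def by auto
    moreover have "e' \<noteq> e" using 1(2) w F(2) by auto
    ultimately show "e' \<in> parallel_neighbors P e"
      unfolding parallel_neighbors_def sv sf by simp blast
  qed
  have "S u \<inter> S v = {}"
  proof (rule ccontr)
    assume "S u \<inter> S v \<noteq> {}"
    then obtain e' where e': "e' \<in> S u" "e' \<in> S v" by blast
    then have "e' = e"
      unfolding S_def edges_at_def using edge_eqI[OF polytope e, of e' u v] uv w by auto
    then show False using e' X2(2)[of u F] unfolding S_def by simp
  qed
  moreover have "D F \<inter> D G = {}"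
  proof (rule ccontr)
    assume "D F \<inter> D G \<noteq> {}"
    then obtain e' where e': "e' \<in> D F" "e' \<in> D G" by blast
    then have "e' edge_of P" "e' \<subseteq> F" "e' \<subseteq> G" unfolding D_def edges_in_def by auto
    then have "F \<inter> G = e'" by (rule two_faces_Int_eq_edge[OF F(1) G(1) FG(2)])
    moreover have "F \<inter> G = e" using two_faces_Int_eq_edge[OF F(1) G(1) FG(2) e F(2) G(2)] .
    ultimately have "e' = e" by simp
    then show False using e' X2(2)[of u F] unfolding D_def by simp
  qed
  moreover have "(S u \<union> S v) \<inter> (D F \<union> D G) = {}"
    unfolding S_def D_def X_def edges_at_def edges_in_def by auto
  moreover have fin: "finite (S z)" "finite (D H)" for z H
    unfolding S_def D_def using finite_edges_at finite_edges_in by auto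
  ultimately have "card (S u \<union> S v \<union> (D F \<union> D G)) = card (S u) + card (S v) + (card (D F) + card (D G))"
    by (simp add: card_Un_disjoint)
  moreover have "finite (parallel_neighbors P e)"
    using finite_edges unfolding parallel_neighbors_def by (rule rev_finite_subset) auto
  then have "card (S u \<union> S v \<union> (D F \<union> D G)) \<le> card (parallel_neighbors P e)"
    using sub by (rule card_mono)
  ultimately show ?thesis using cS[of u] cS[of v] cD[of F] cD[of G] by simp
qed

lemma card_edges_le:
  assumes "forman_ricci_positive P"
  shows "16 * card {e. e edge_of P} \<le> 15 * (card (vertices P) + card (two_faces P))"
proof -
  let ?V = "vertices P" and ?E = "{e. e edge_of P}" and ?T = "two_faces P"
  let ?s = "\<lambda>e. (\<Sum>v\<in>{v \<in> ?V. v \<in> e}. 1 / real (card (edges_at v))) +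
    (\<Sum>F\<in>{F \<in> ?T. e \<subseteq> F}. 1 / real (card (edges_in F)))"
  have s: "16 / 15 \<le> ?s e" if e: "e \<in> ?E" for e
  proof -
    have e': "e edge_of P" using e by simp
    obtain u v where uv: "?V \<inter> e = {u, v}" "u \<noteq> v"
      using card_vertices_edge[OF polytope e'] by (meson card_2_iff)
    obtain F G where FG: "two_faces_above P e = {F, G}" "F \<noteq> G"
      using card_two_faces_above[OF e'] by (meson card_2_iff)
    \<comment> \<open>With two 2-faces above \<open>e\<close>, positive curvature reads
      \<open>2 + 2 - card (parallel_neighbors P e) > 0\<close>.\<close>
    have "card (parallel_neighbors P e) \<le> 3"
      using assms e' card_two_faces_above[OF e']
      unfolding forman_ricci_positive_def forman_ricci_def by fastforce
    then have le: "card (edges_at u) + card (edges_at v) + card (edges_in F) + card (edges_in G) \<le> 15"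
      using card_parallel_neighbors_ge[OF e' uv FG] by simp
    have "e \<in> edges_at u" "e \<in> edges_at v" using uv e' unfolding edges_at_def by auto
    moreover have "e \<in> edges_in F" "e \<in> edges_in G"
      using FG(1) e' unfolding edges_in_def two_faces_above_def by auto
    ultimately have pos: "card (edges_at u) > 0" "card (edges_at v) > 0"
      "card (edges_in F) > 0" "card (edges_in G) > 0"
      using finite_edges_at finite_edges_in by (auto simp: card_gt_0_iff)
    have "?s e = 1 / real (card (edges_at u)) + 1 / real (card (edges_at v)) +
      (1 / real (card (edges_in F)) + 1 / real (card (edges_in G)))"
      using uv FG unfolding two_faces_above_def by (simp add: Int_def)
    \<comment> \<open>Adding the four tangent bounds gives at least
      \<open>4 * 8 / 15 - 16 / 225 * 15 = 16 / 15\<close>.\<close>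
    then show ?thesis
      using pos[THEN of_nat_0_less_iff[THEN iffD2], THEN inverse_ge_tangent] le by linarith
  qed
  have fV: "finite ?V" using finite_vertices polytope by blast
  have "16 / 15 * real (card ?E) = (\<Sum>e\<in>?E. 16 / 15)" by simp
  also have "\<dots> \<le> (\<Sum>e\<in>?E. ?s e)" using s by (rule sum_mono)
  also have "\<dots> = (\<Sum>e\<in>?E. \<Sum>v\<in>{v \<in> ?V. v \<in> e}. 1 / real (card (edges_at v))) +
    (\<Sum>e\<in>?E. \<Sum>F\<in>{F \<in> ?T. e \<subseteq> F}. 1 / real (card (edges_in F)))"
    by (rule sum.distrib)
  also have "\<dots> \<le> real (card ?V) + real (card ?T)"
    unfolding edges_at_def edges_in_def
    by (intro add_mono sum_inverse_degree_le fV finite_edges finite_two_faces)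
  finally have "real (16 * card ?E) \<le> real (15 * (card ?V + card ?T))" by simp
  then show ?thesis by (simp only: of_nat_le_iff)
qed

end

theorem theorem2p14:
  fixes P :: "'a::euclidean_space set"
  assumes "polytope P"
    and "aff_dim P = 3"
    and "forman_ricci_positive P"
  shows "f0 P \<le> 16 \<or> f2 P \<le> 16"
proof -
  interpret polytope3 P by (rule polytope3.intro[OF assms(1,2)])
  show ?thesis
  proof (rule ccontr)
    assume "\<not> ?thesis"
    then have "card (vertices P) \<ge> 17" "card (two_faces P) \<ge> 17" unfolding f0_def f2_def by auto
    \<comment> \<open>Writing \<open>n\<close> for the number of vertices and 2-faces together, the
      two bounds give \<open>16 * n \<le> 15 * n + 32\<close>, contrary to
      \<open>n \<ge> 34\<close>.\<close>
    then show False
      using card_edges_le[OF assms(3)] card_vertices_two_faces_le by (simp add: algebra_simps)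
  qed
qed

end
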